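(* Let $f \colon X \to Y$ be a mapping of a metrizable completely Baire space $X$ to a regular space $Y$. Then the following conditions are equivalent: (i) $f$ is resolvable-measurable; (ii) $f$ is piecewise continuous; (iii) $f$ is $\mathbf{\Pi}^0_2$-measurable.
   Context: Mappings are not assumed continuous. Regular spaces are understood in the sense of Engelking's "General Topology" (in particular, they are $T_1$). A topological space $X$ is a Baire space if the intersection of countably many dense open sets in $X$ is dense. A space $X$ is completely Baire if every closed subspace of $X$ is a Baire space. A subset $E$ of a space $X$ is resolvable if it can be represented as $E = (F_1 \setminus F_2) \cup (F_3 \setminus F_4) \cup \ldots \cup (F_\xi \setminus F_{\xi+1}) \cup \ldots$, where $\langle F_\xi \rangle$ is a decreasing transfinite sequence of closed sets in $X$. Equivalently (indexing from $0$), there are an ordinal $\kappa$ and a decreasing sequence $\langle F_\xi \colon \xi < \kappa\rangle$ of closed sets such that $E$ is the union of $F_\xi \setminus F_{\xi+1}$ over all even ordinals $\xi$ with $\xi+1<\kappa$ (an ordinal is even if it has the form $\lambda + 2n$ with $\lambda$ zero or a limit ordinal and $n<\omega$). A mapping $f \colon X \to Y$ is: - resolvable-measurable if $f^{-1}(U)$ is a resolvable subset of $X$ for every open set $U \subset Y$; - $\mathbf{\Pi}^0_2$-measurable if $f^{-1}(U) \in \mathbf{\Pi}^0_2(X)$, i.e. $f^{-1}(U)$ is a $G_\delta$-set in $X$, for every open set $U \subset Y$; - piecewise continuous if $X$ can be covered by a sequence $X_0, X_1, \ldots$ of closed sets such that the restriction $f \upharpoonright X_n$ is continuous for every $n \in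 \omega$. *)

theory Defs
  imports "HOL-Analysis.Analysis"
begin

definition Baire_space :: "'a topology \<Rightarrow> bool" where
  "Baire_space X \<longleftrightarrow>
     (\<forall>\<U>. countable \<U> \<and> (\<forall>U\<in>\<U>. openin X U \<and> X closure_of U = topspace X)
        \<longrightarrow> X closure_of (topspace X \<inter> \<Inter>\<U>) = topspace X)"

definition completely_Baire_space :: "'a topology \<Rightarrow> bool" where
  "completely_Baire_space X \<longleftrightarrow> (\<forall>C. closedin X C \<longrightarrow> Baire_space (subtopology X C))"

text \<open>An ordinal \<open>\<kappa>\<close> is represented by a (non-strict) well-order \<open>r\<close> of type \<open>\<kappa>\<close>, the ordinals
  \<open>\<xi> < \<kappa>\<close> being the elements of \<^term>\<open>Field r\<close>. Then \<open>ord_succ r \<xi> \<eta>\<close> says that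
  \<open>\<eta> = \<xi> + 1 < \<kappa>\<close>.\<close>

definition ord_succ :: "'i rel \<Rightarrow> 'i \<Rightarrow> 'i \<Rightarrow> bool" where
  "ord_succ r \<xi> \<eta> \<longleftrightarrow> \<eta> \<in> aboveS r \<xi> \<and> (\<forall>\<zeta>\<in>aboveS r \<xi>. (\<eta>, \<zeta>) \<in> r)"

text \<open>Rule \<open>base\<close> covers exactly zero and the limit ordinals.\<close>

inductive ord_even :: "'i rel \<Rightarrow> 'i \<Rightarrow> bool" for r where
  base: "\<xi> \<in> Field r \<Longrightarrow> \<nexists>\<zeta>. ord_succ r \<zeta> \<xi> \<Longrightarrow> ord_even r \<xi>"
| step: "ord_even r \<xi> \<Longrightarrow> ord_succ r \<xi> \<eta> \<Longrightarrow> ord_succ r \<eta> \<zeta> \<Longrightarrow> ord_even r \<zeta>"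

definition resolvable_along :: "'i rel \<Rightarrow> 'a topology \<Rightarrow> 'a set \<Rightarrow> bool" where
  "resolvable_along r X E \<longleftrightarrow>
     Well_order r \<and>
     (\<exists>F. (\<forall>\<xi>\<in>Field r. closedin X (F \<xi>)) \<and>
          (\<forall>\<xi> \<eta>. (\<xi>, \<eta>) \<in> r \<longrightarrow> F \<eta> \<subseteq> F \<xi>) \<and>
          E = \<Union>{F \<xi> - F \<eta> | \<xi> \<eta>. ord_even r \<xi> \<and> ord_succ r \<xi> \<eta>})"

text \<open>HOL cannot quantify over all ordinals, so the well-order lives on a fixed type. This is no
  restriction: by \<open>resolvable_inI\<close> below, a well-order on any type whatsoever may be used.\<close>

definition resolvable_in :: "'a topology \<Rightarrow> 'a set \<Rightarrow> bool" where
  "resolvable_in X E \<longleftrightarrow> (\<exists>r :: ('a set \<times> bool) rel. resolvable_along r X E)"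

definition resolvable_measurable :: "'a topology \<Rightarrow> 'b topology \<Rightarrow> ('a \<Rightarrow> 'b) \<Rightarrow> bool" where
  "resolvable_measurable X Y f \<longleftrightarrow>
     (\<forall>U. openin Y U \<longrightarrow> resolvable_in X {x \<in> topspace X. f x \<in> U})"

definition Pi02_measurable :: "'a topology \<Rightarrow> 'b topology \<Rightarrow> ('a \<Rightarrow> 'b) \<Rightarrow> bool" where
  "Pi02_measurable X Y f \<longleftrightarrow>
     (\<forall>U. openin Y U \<longrightarrow> gdelta_in X {x \<in> topspace X. f x \<in> U})"

definition piecewise_continuous :: "'a topology \<Rightarrow> 'b topology \<Rightarrow> ('a \<Rightarrow> 'b) \<Rightarrow> bool" where
  "piecewise_continuous X Y f \<longleftrightarrow>
     (\<exists>C :: nat \<Rightarrow> 'a set. (\<forall>n. closedin X (C n)) \<and> (\<Union>n. C n) = topspace X \<and>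
        (\<forall>n. continuous_map (subtopology X (C n)) Y f))"

text \<open>The proof doubles each value \<open>A\<close> of the given sequence: the new sequence takes the value
  \<open>A\<close> at the even index \<open>(A, False)\<close>, and at the odd index \<open>(A, True)\<close> either the next value or
  again \<open>A\<close>, according to whether the difference is to be included.\<close>

theorem resolvable_inI:
  fixes r :: "'i rel" and X :: "'a topology"
  assumes "resolvable_along r X E"
  shows "resolvable_in X E"
proof -
  from assms obtain F where W: "Well_order r"
    and cl: "\<And>\<xi>. \<xi> \<in> Field r \<Longrightarrow> closedin X (F \<xi>)"
    and dec: "\<And>\<xi> \<eta>. (\<xi>, \<eta>) \<in> r \<Longrightarrow> F \<eta> \<subseteq> F \<xi>"
    and E: "E = \<Union>{F \<xi> - F \<eta> | \<xi> \<eta>. ord_even r \<xi> \<and> ord_succ r \<xi> \<eta>}"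
    unfolding resolvable_along_def by blast
  have tot: "(\<xi>, \<eta>) \<in> r \<or> (\<eta>, \<xi>) \<in> r" if "\<xi> \<in> Field r" "\<eta> \<in> Field r" for \<xi> \<eta>
    using W that wo_rel.TOTALS[of r] unfolding wo_rel_def by blast
  have wf: "wf (r - Id)" using W by (simp add: well_order_on_def)
  define G where "G = F ` Field r"
  have lin: "A \<subseteq> B \<or> B \<subseteq> A" if "A \<in> G" "B \<in> G" for A B
    using that tot dec unfolding G_def by blast
  have fld: "\<xi> \<in> Field r" "\<eta> \<in> Field r" "(\<xi>, \<eta>) \<in> r" if "ord_succ r \<xi> \<eta>" for \<xi> \<eta>
    using that by (auto simp: ord_succ_def aboveS_def intro: FieldI1 FieldI2)
  define S where "S = {A. \<exists>\<xi> \<eta>. ord_even r \<xi> \<and> ord_succ r \<xi> \<eta> \<and> F \<xi> = A \<and> F \<eta> \<noteq> A}"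
  define N where "N A = \<Union>{B \<in> G. B \<subset> A}" for A
  have N: "N (F \<xi>) = F \<eta>" if "ord_succ r \<xi> \<eta>" "F \<eta> \<noteq> F \<xi>" for \<xi> \<eta>
  proof
    show "F \<eta> \<subseteq> N (F \<xi>)"
      using fld[OF that(1)] dec that(2) unfolding N_def G_def by blast
    show "N (F \<xi>) \<subseteq> F \<eta>"
    proof -
      have "B \<subseteq> F \<eta>" if B: "B \<in> G" "B \<subset> F \<xi>" for B
      proof -
        obtain \<zeta> where z: "\<zeta> \<in> Field r" "B = F \<zeta>" using B G_def by blast
        have "(\<zeta>, \<xi>) \<notin> r" using dec z B by blast
        hence "(\<xi>, \<zeta>) \<in> r" "\<zeta> \<noteq> \<xi>" using tot z fld[OF \<open>ord_succ r \<xi> \<eta>\<close>] by blast+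
        hence "(\<eta>, \<zeta>) \<in> r" using \<open>ord_succ r \<xi> \<eta>\<close> by (simp add: ord_succ_def aboveS_def)
        thus ?thesis using dec z by blast
      qed
      thus ?thesis unfolding N_def by blast
    qed
  qed
  define q where "q = {((A, a), (B, b)). A \<in> G \<and> B \<in> G \<and> (B \<subset> A \<or> A = B \<and> (a \<longrightarrow> b))}"
  have q: "((A, a), (B, b)) \<in> q \<longleftrightarrow> A \<in> G \<and> B \<in> G \<and> (B \<subset> A \<or> A = B \<and> (a \<longrightarrow> b))" for A a B b
    by (simp add: q_def)
  have Fq: "Field q = G \<times> UNIV"
  proof
    show "Field q \<subseteq> G \<times> UNIV" by (auto simp: Field_def q_def)
    show "G \<times> UNIV \<subseteq> Field q"
    proof
      fix x assume "x \<in> G \<times> (UNIV :: bool set)"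
      hence "(x, x) \<in> q" by (cases x) (simp add: q)
      thus "x \<in> Field q" by (rule FieldI1)
    qed
  qed
  have wfq: "wf (q - Id)"
  proof -
    define p where "p A = (SOME \<xi>. \<xi> \<in> Field r \<and> F \<xi> = A)" for A
    have p: "p A \<in> Field r" "F (p A) = A" if "A \<in> G" for A
    proof -
      have "\<exists>\<xi>. \<xi> \<in> Field r \<and> F \<xi> = A" using that unfolding G_def by blast
      from someI_ex[OF this] show "p A \<in> Field r" "F (p A) = A" unfolding p_def by auto
    qed
    have "wf {(False, True)}" by (simp add: wf_insert)
    hence "wf (inv_image ((r - Id) <*lex*> {(False, True)}) (\<lambda>(A, a). (p A, a)))"
      using wf by (intro wf_inv_image wf_lex_prod)
    moreover have "q - Id \<subseteq> inv_image ((r - Id) <*lex*> {(False, True)}) (\<lambda>(A, a). (p A, a))"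
    proof
      fix z assume z: "z \<in> q - Id"
      obtain A a B b where zz: "z = ((A, a), (B, b))" by (metis surj_pair)
      have AB: "A \<in> G" "B \<in> G" using z zz q by auto
      show "z \<in> inv_image ((r - Id) <*lex*> {(False, True)}) (\<lambda>(A, a). (p A, a))"
      proof (cases "A = B")
        case True
        thus ?thesis using z zz q by auto
      next
        case False
        hence "B \<subset> A" using z zz q by auto
        hence "(p B, p A) \<notin> r" using dec[of "p B" "p A"] p AB by auto
        hence "(p A, p B) \<in> r - Id" using tot p AB \<open>A \<noteq> B\<close> by (metis DiffI pair_in_Id_conv)
        thus ?thesis unfolding zz by simp
      qed
    qed
    ultimately show ?thesis by (rule wf_subset)
  qed
  have Wq: "Well_order q"
    unfolding well_order_on_def linear_order_on_def partial_order_on_def preorder_on_def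
  proof (intro conjI)
    show "refl_on (Field q) q" unfolding refl_on_def Fq by (auto simp: q)
    show "trans q" unfolding trans_def by (auto simp: q)
    show "antisym q" unfolding antisym_def by (auto simp: q)
    show "total_on (Field q) q" unfolding total_on_def Fq using lin by (auto simp: q)
    show "wf (q - Id)" by (rule wfq)
    show "q \<subseteq> Field q \<times> Field q" by (auto intro: FieldI1 FieldI2)
  qed
  have sFT: "ord_succ q (A, False) y \<longleftrightarrow> A \<in> G \<and> y = (A, True)" for A y
  proof (cases y)
    case (Pair B b)
    show ?thesis unfolding Pair ord_succ_def aboveS_def by (auto simp: q)
  qed
  have sT: "\<exists>B\<in>G. y = (B, False)" if "ord_succ q (A, True) y" for A y
  proof (cases y)
    case (Pair B b)
    with that have B: "A \<in> G" "B \<in> G" "B \<subset> A" by (auto simp: ord_succ_def aboveS_def q)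
    hence "((B, b), (B, False)) \<in> q"
      using that unfolding Pair ord_succ_def aboveS_def by (auto simp: q)
    thus ?thesis using B Pair by (auto simp: q)
  qed
  have ev1: "\<exists>A\<in>G. x = (A, False)" if "ord_even q x" for x
    using that
  proof induction
    case (base x)
    obtain A a where x: "x = (A, a)" by (cases x)
    hence "A \<in> G" using base Fq by auto
    moreover from this have "\<not> a" using base(2) sFT[of A x] x by (cases a) blast+
    ultimately show ?case using x by simp
  next
    case (step x y z)
    then obtain A where "x = (A, False)" by blast
    hence "y = (A, True)" using step sFT by blast
    thus ?case using step sT by blast
  qed
  have ev2: "A \<in> G \<Longrightarrow> x = (A, False) \<Longrightarrow> ord_even q x" for A x
  proof (induction x arbitrary: A rule: wf_induct_rule[OF wfq])
    case (1 x)
    show ?case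
    proof (cases "\<exists>y. ord_succ q y x")
      case False
      thus ?thesis using 1 Fq by (intro ord_even.base) auto
    next
      case True
      then obtain B b where y: "ord_succ q (B, b) x" by (metis surj_pair)
      hence b: "b = True" using sFT 1 by (cases b) auto
      have m: "((B, True), x) \<in> q" "(B, True) \<noteq> x" using y b by (auto simp: ord_succ_def aboveS_def)
      hence BG: "B \<in> G" using 1 by (auto simp: q)
      have "((B, False), x) \<in> q - Id" using m 1 by (auto simp: q)
      hence "ord_even q (B, False)" using 1 BG by blast
      thus ?thesis using y b sFT BG ord_even.step by metis
    qed
  qed
  define H where "H = (\<lambda>(A, a). if a \<and> A \<in> S then N A else A)"
  have SG: "closedin X (N A)" if "A \<in> S" for A
  proof -
    obtain \<xi> \<eta> where *: "ord_succ r \<xi> \<eta>" "F \<xi> = A" "F \<eta> \<noteq> A" using \<open>A \<in> S\<close> S_def by blast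
    hence "N A = F \<eta>" using N by blast
    thus ?thesis using cl fld * by metis
  qed
  have "resolvable_along q X E"
    unfolding resolvable_along_def
  proof (intro conjI exI[of _ H] allI impI ballI)
    show "Well_order q" by (rule Wq)
    fix x assume x: "x \<in> Field q"
    obtain A a where A: "x = (A, a)" by (cases x)
    hence "A \<in> G" using x Fq by blast
    hence "closedin X A" using cl unfolding G_def by blast
    thus "closedin X (H x)" using SG[of A] unfolding A H_def by simp
  next
    fix x y assume xy: "(x, y) \<in> q"
    have NA: "N A \<subseteq> A" for A unfolding N_def by blast
    obtain A a B b where AB: "x = (A, a)" "y = (B, b)" by (metis surj_pair)
    consider "A \<in> G" "B \<in> G" "B \<subset> A" | "A = B" "a \<longrightarrow> b" using xy q AB by blast
    thus "H y \<subseteq> H x"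
    proof cases
      case 1
      have "H y \<subseteq> B" using NA[of B] unfolding AB H_def by simp
      moreover have "B \<subseteq> N A" using 1 unfolding N_def by blast
      hence "B \<subseteq> H x" using 1(3) unfolding AB H_def by (simp add: psubset_imp_subset)
      ultimately show ?thesis by (rule subset_trans)
    next
      case 2
      thus ?thesis using NA[of A] unfolding AB H_def by simp
    qed
  next
    have ev: "ord_even q x \<and> ord_succ q x y \<longleftrightarrow> (\<exists>A\<in>G. x = (A, False) \<and> y = (A, True))" for x y
      using ev1[of x] ev2[of _ x] sFT by blast
    have "\<Union>{H x - H y | x y. ord_even q x \<and> ord_succ q x y} = (\<Union>A\<in>G. H (A, False) - H (A, True))"
      unfolding ev by blast
    also have "\<dots> = (\<Union>A\<in>S. A - N A)"
    proof -
      have "S \<subseteq> G" using fld unfolding S_def G_def by blast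
      moreover have "H (A, False) - H (A, True) = (if A \<in> S then A - N A else {})" for A
        unfolding H_def by simp
      ultimately show ?thesis by auto
    qed
    also have "\<dots> = E"
      unfolding E
    proof (intro equalityI subsetI)
      fix x assume "x \<in> (\<Union>A\<in>S. A - N A)"
      then obtain \<xi> \<eta> where "ord_even r \<xi>" "ord_succ r \<xi> \<eta>" "F \<eta> \<noteq> F \<xi>" "x \<in> F \<xi> - N (F \<xi>)"
        unfolding S_def by blast
      thus "x \<in> \<Union>{F \<xi> - F \<eta> | \<xi> \<eta>. ord_even r \<xi> \<and> ord_succ r \<xi> \<eta>}" using N by blast
    next
      fix x assume "x \<in> \<Union>{F \<xi> - F \<eta> | \<xi> \<eta>. ord_even r \<xi> \<and> ord_succ r \<xi> \<eta>}"
      then obtain \<xi> \<eta> where *: "ord_even r \<xi>" "ord_succ r \<xi> \<eta>" "x \<in> F \<xi> - F \<eta>" by blast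
      hence "F \<eta> \<noteq> F \<xi>" by blast
      thus "x \<in> (\<Union>A\<in>S. A - N A)" using * N unfolding S_def by blast
    qed
    finally show "E = \<Union>{H x - H y | x y. ord_even q x \<and> ord_succ q x y}" by simp
  qed
  thus ?thesis unfolding resolvable_in_def by blast
qed

end

theory Submission
  imports Defs
begin

text \<open>Call \<open>f\<close> separating if no nonempty \<open>T\<close> has dense intersections with the preimages of
  two disjoint open sets. A resolvable set is locally constant somewhere on every nonempty set, and
  two disjoint \<open>G\<^sub>\<delta>\<close> sets cannot both be dense in a nonempty Baire space; so (i) and (iii) both
  imply that \<open>f\<close> is separating.

  A separating map into a regular space is weakly discontinuous: every nonempty \<open>T\<close> has a
  nonempty relatively open subset on which \<open>f\<close> is continuous. Otherwise one picks inductively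
  points \<open>p\<^sub>n\<close> and disjoint open \<open>U\<^sub>n\<close> containing \<open>f p\<^sub>n\<close>, where each point is a limit both of
  later points of even and of later points of odd index; the unions of the \<open>U\<^sub>n\<close> over even and odd
  indices then contradict separation. For the induction to go on, \<open>f\<close> has to stay wild near every
  chosen point after the preimages of the closures of all \<open>U\<^sub>n\<close> so far have been removed.

  Peeling off such relatively open pieces transfinitely gives a decreasing sequence of closed sets on
  whose successive differences \<open>f\<close> is continuous; in a metric space these differences can be
  regrouped into countably many closed sets. Conversely, under (ii) preimages of open sets and their
  complements are \<open>G\<^sub>\<delta>\<close>, hence locally constant somewhere on every closed set by Baire, and the
  same transfinite peeling shows that they are resolvable.\<close>

section \<open>Transfinite derivatives and resolvable sets\<close>

text \<open>Keep removing a relatively open piece that satisfies \<open>P\<close>, intersecting at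
  limit stages. Each nonempty stage loses a point, and different stages lose different points. By
  Cantor there are more indices than points, so some stage is empty.\<close>

lemma transfinite_derivative:
  fixes X :: "'a topology"
  assumes step: "\<And>C. closedin X C \<Longrightarrow> C \<noteq> {} \<Longrightarrow> \<exists>V. openin X V \<and> V \<inter> C \<noteq> {} \<and> P (V \<inter> C)"
    and empty: "P {}"
  obtains r :: "'a set rel" and F G :: "'a set \<Rightarrow> 'a set"
  where "Well_order r" "Field r = UNIV"
    "\<And>i. closedin X (F i)" "\<And>i. closedin X (G i)" "\<And>i. G i \<subseteq> F i" "\<And>i. P (F i - G i)"
    "\<And>i j. (i, j) \<in> r \<Longrightarrow> i \<noteq> j \<Longrightarrow> F j \<subseteq> G i" "(\<Union>i. F i - G i) = topspace X"
proof -
  obtain r :: "'a set rel" where r: "Well_order r" "Field r = UNIV"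
    using well_ordering[where 'a = "'a set"] by (elim exE conjE)
  have wf: "wf (r - Id)" using r by (simp add: well_order_on_def)
  have tot: "(i, j) \<in> r - Id \<or> (j, i) \<in> r - Id" if "i \<noteq> j" for i j
    using r that by (auto simp: well_order_on_def linear_order_on_def total_on_def)
  have "\<exists>C'. (closedin X C \<longrightarrow> closedin X C' \<and> C' \<subseteq> C \<and> P (C - C') \<and> (C \<noteq> {} \<longrightarrow> C' \<noteq> C))" for C
  proof (cases "closedin X C \<and> C \<noteq> {}")
    case True
    then obtain V where V: "openin X V" "V \<inter> C \<noteq> {}" "P (V \<inter> C)" using step by blast
    have "closedin X (C - V)" "C - V \<subseteq> C" "C - V \<noteq> C" "C - (C - V) = V \<inter> C"
      using V True by auto
    thus ?thesis using V by metis
  next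
    case False
    thus ?thesis using empty by (intro exI[of _ C]) auto
  qed
  then obtain g where g: "\<And>C. closedin X C \<Longrightarrow> closedin X (g C)" "\<And>C. closedin X C \<Longrightarrow> g C \<subseteq> C"
    "\<And>C. closedin X C \<Longrightarrow> P (C - g C)" "\<And>C. closedin X C \<Longrightarrow> C \<noteq> {} \<Longrightarrow> g C \<noteq> C"
    by metis
  \<comment> \<open>At a successor this is \<open>g\<close> of the preceding stage, at a limit the
    intersection of all earlier ones. The factor \<open>topspace X\<close> gives the value at the
    least index, where the intersection is over no sets.\<close>
  define F where "F = wfrec (r - Id) (\<lambda>F i. topspace X \<inter> (\<Inter>j\<in>{j. (j, i) \<in> r - Id}. g (F j)))"
  have F: "F i = topspace X \<inter> (\<Inter>j\<in>{j. (j, i) \<in> r - Id}. g (F j))" for i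
    unfolding F_def by (subst wfrec[OF wf]) (simp add: cut_apply)
  have cl: "closedin X (F i)" for i
  proof (induction i rule: wf_induct_rule[OF wf])
    case (1 i)
    have "closedin X (\<Inter> (insert (topspace X) ((\<lambda>j. g (F j)) ` {j. (j, i) \<in> r - Id})))"
      using 1 g by (intro closedin_Inter) auto
    thus ?case by (subst F) simp
  qed
  have dec: "F j \<subseteq> g (F i)" if "(i, j) \<in> r - Id" for i j
    using that by (subst F) blast
  have dis: "i = j" if "x \<in> F i - g (F i)" "x \<in> F j - g (F j)" for x i j
    using that dec tot[of i j] by blast
  have "\<exists>i. F i = {}"
  proof (rule ccontr)
    assume "\<nexists>i. F i = {}"
    hence "\<exists>x. x \<in> F i - g (F i)" for i using g(2,4)[OF cl[of i]] by blast
    then obtain x where x: "x i \<in> F i - g (F i)" for i by metis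
    have "inj x" using dis x by (metis injI)
    hence "\<exists>h :: 'a \<Rightarrow> 'a set. surj h" using inj_imp_surj_inv by blast
    thus False using Cantors_theorem[of UNIV] by auto
  qed
  have cover: "x \<in> (\<Union>i. F i - g (F i))" if x: "x \<in> topspace X" for x
  proof -
    obtain k where "x \<notin> F k" using \<open>\<exists>i. F i = {}\<close> by blast
    hence "k \<in> {k. x \<notin> F k}" by simp
    \<comment> \<open>The first stage \<open>k\<close> lacking \<open>x\<close> follows some stage
      \<open>j\<close> that still contains \<open>x\<close> but whose removal step discards
      it.\<close>
    from wfE_min[OF wf this] obtain k where k: "x \<notin> F k" "\<And>j. (j, k) \<in> r - Id \<Longrightarrow> x \<in> F j"
      by (metis (mono_tags, lifting) mem_Collect_eq)
    from k(1) x obtain j where "(j, k) \<in> r - Id" "x \<notin> g (F j)" by (subst (asm) F) blast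
    thus ?thesis using k(2) by blast
  qed
  show ?thesis
  proof (rule that[of r F "\<lambda>i. g (F i)"])
    show "(\<Union>i. F i - g (F i)) = topspace X" using cover closedin_subset[OF cl] by blast
  qed (use r cl g dec in auto)
qed

text \<open>Doubling every index makes all \<open>(i, False)\<close> even, so that a stage of a transfinite
  sequence can be included in a resolvable set regardless of its parity.\<close>

definition doubled :: "'i rel \<Rightarrow> ('i \<times> bool) rel" where
  "doubled r = {((i, a), (j, b)). (i, j) \<in> r \<and> (i = j \<longrightarrow> a \<longrightarrow> b)}"

lemma doubled_iff: "((i, a), (j, b)) \<in> doubled r \<longleftrightarrow> (i, j) \<in> r \<and> (i = j \<longrightarrow> a \<longrightarrow> b)"
  by (simp add: doubled_def)

lemma Well_order_doubled:
  assumes "Well_order r" "Field r = UNIV"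
  shows "Well_order (doubled r)" "Field (doubled r) = UNIV"
proof -
  have r: "refl r" "trans r" "antisym r" "total r" "wf (r - Id)"
    using assms
    by (auto simp: well_order_on_def linear_order_on_def partial_order_on_def preorder_on_def)
  have refl: "(i, i) \<in> r" for i using r by (auto simp: refl_on_def)
  have "(x, x) \<in> doubled r" for x by (cases x) (simp add: doubled_iff refl)
  thus Fld: "Field (doubled r) = UNIV" by (auto intro: FieldI1)
  have "wf {(False, True)}" by (simp add: wf_insert)
  hence "wf ((r - Id) <*lex*> {(False, True)})" using r by (intro wf_lex_prod)
  moreover have "doubled r - Id \<subseteq> (r - Id) <*lex*> {(False, True)}" by (auto simp: doubled_def)
  ultimately have "wf (doubled r - Id)" by (rule wf_subset)
  moreover have "refl (doubled r)" using refl by (auto simp: refl_on_def doubled_iff)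
  moreover have "trans (doubled r)"
  proof (rule transI)
    fix x y z assume "(x, y) \<in> doubled r" "(y, z) \<in> doubled r"
    thus "(x, z) \<in> doubled r"
      using transD[OF r(2)] antisymD[OF r(3)]
      by (cases x; cases y; cases z) (auto simp: doubled_iff; blast)
  qed
  moreover have "antisym (doubled r)"
    using antisymD[OF r(3)] by (auto simp: antisym_def doubled_iff)
  moreover have "total (doubled r)"
  proof (rule total_onI)
    fix x y :: "'a \<times> bool" assume "x \<noteq> y"
    obtain i a j b where xy: "x = (i, a)" "y = (j, b)" by (metis surj_pair)
    show "(x, y) \<in> doubled r \<or> (y, x) \<in> doubled r"
    proof (cases "i = j")
      case True
      thus ?thesis using refl xy by (auto simp: doubled_iff)
    next
      case False
      hence "(i, j) \<in> r \<or> (j, i) \<in> r" using r(4) by (simp add: total_on_def)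
      thus ?thesis using False xy by (auto simp: doubled_iff)
    qed
  qed
  ultimately show "Well_order (doubled r)"
    unfolding well_order_on_def linear_order_on_def partial_order_on_def preorder_on_def Fld by simp
qed

text \<open>Each immediate successor flips the flag, so steps of two preserve it. An index
  \<open>(i, True)\<close> always succeeds \<open>(i, False)\<close>, hence zero and the limits
  carry the flag \<open>False\<close>.\<close>

lemma ord_even_doubled:
  assumes "Well_order r" "Field r = UNIV"
  shows "ord_even (doubled r) x \<and> ord_succ (doubled r) x y \<longleftrightarrow> (\<exists>i. x = (i, False) \<and> y = (i, True))"
proof -
  have r: "refl r" "antisym r" "wf (r - Id)" 
    using assms
    by (auto simp: well_order_on_def linear_order_on_def partial_order_on_def preorder_on_def)
  have refl: "(i, i) \<in> r" for i using r by (auto simp: refl_on_def)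
  have sF: "ord_succ (doubled r) (i, False) y \<longleftrightarrow> y = (i, True)" for i y
  proof (cases y)
    case (Pair j b)
    show ?thesis
    proof
      assume y: "ord_succ (doubled r) (i, False) y"
      have "(i, True) \<in> aboveS (doubled r) (i, False)" by (simp add: aboveS_def doubled_iff refl)
      with y have "(y, (i, True)) \<in> doubled r" "((i, False), y) \<in> doubled r" "y \<noteq> (i, False)"
        by (auto simp: ord_succ_def aboveS_def)
      thus "y = (i, True)" using antisymD[OF r(2)] Pair by (auto simp: doubled_iff)
    next
      assume "y = (i, True)"
      thus "ord_succ (doubled r) (i, False) y"
        by (auto simp: ord_succ_def aboveS_def doubled_iff refl)
    qed
  qed
  have sT: "\<exists>j. (i, j) \<in> r \<and> i \<noteq> j \<and> y = (j, False)" if "ord_succ (doubled r) (i, True) y" for i y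
  proof (cases y)
    case (Pair j b)
    with that have j: "(i, j) \<in> r" "i \<noteq> j" by (auto simp: ord_succ_def aboveS_def doubled_iff)
    hence "((j, b), (j, False)) \<in> doubled r"
      using that unfolding Pair ord_succ_def aboveS_def by (auto simp: doubled_iff)
    thus ?thesis using j Pair by (auto simp: doubled_iff)
  qed
  have ev1: "\<exists>i. x = (i, False)" if "ord_even (doubled r) x" for x
    using that
  proof induction
    case (base x)
    thus ?case using sF by (metis surj_pair)
  next
    case (step x y z)
    thus ?case using sF sT by metis
  qed
  have ev2: "ord_even (doubled r) (i, False)" for i
  proof (induction i rule: wf_induct_rule[OF r(3)])
    case (1 i)
    show ?case
    proof (cases "\<exists>y. ord_succ (doubled r) y (i, False)")
      case False
      thus ?thesis using Well_order_doubled[OF assms] by (intro ord_even.base) auto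
    next
      case True
      then obtain j b where y: "ord_succ (doubled r) (j, b) (i, False)" by (metis surj_pair)
      hence b: "b" using sF[of j "(i, False)"] by (cases b) auto
      hence "(j, i) \<in> r - Id" using y sT[of j "(i, False)"] by auto
      hence "ord_even (doubled r) (j, False)" using 1 by blast
      thus ?thesis using y b sF[of j "(j, True)"] ord_even.step by (metis (full_types))
    qed
  qed
  show ?thesis using ev1 ev2 sF by blast
qed

lemma resolvable_in_if_locally_constant:
  fixes X :: "'a topology"
  assumes "E \<subseteq> topspace X"
    and "\<And>C. closedin X C \<Longrightarrow> C \<noteq> {} \<Longrightarrow> \<exists>V. openin X V \<and> V \<inter> C \<noteq> {} \<and> (V \<inter> C \<subseteq> E \<or> V \<inter> C \<inter> E = {})"
  shows "resolvable_in X E"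
proof -
  obtain r :: "'a set rel" and F G where r: "Well_order r" "Field r = UNIV"
    and cl: "\<And>i. closedin X (F i)" "\<And>i. closedin X (G i)" and GF: "\<And>i. G i \<subseteq> F i"
    and P: "\<And>i. F i - G i \<subseteq> E \<or> (F i - G i) \<inter> E = {}"
    and dec: "\<And>i j. (i, j) \<in> r \<Longrightarrow> i \<noteq> j \<Longrightarrow> F j \<subseteq> G i" and U: "(\<Union>i. F i - G i) = topspace X"
    by (rule transfinite_derivative[of X "\<lambda>A. A \<subseteq> E \<or> A \<inter> E = {}", OF assms(2)])
      (assumption, assumption, simp, (rule that; assumption))
  \<comment> \<open>The sequence drops from \<open>F i\<close> to \<open>G i\<close> at the odd
    index exactly when the piece \<open>F i - G i\<close> belongs to \<open>E\<close>; otherwise the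
    difference at this pair is empty.\<close>
  define H where "H = (\<lambda>(i, b). if b \<and> F i - G i \<subseteq> E then G i else F i)"
  have "resolvable_along (doubled r) X E"
    unfolding resolvable_along_def
  proof (intro conjI exI[of _ H] ballI allI impI)
    show "Well_order (doubled r)" using Well_order_doubled[OF r] by blast
    fix x show "closedin X (H x)" using cl by (cases x) (simp add: H_def)
  next
    fix x y assume "(x, y) \<in> doubled r"
    moreover obtain i a j b where xy: "x = (i, a)" "y = (j, b)" by (metis surj_pair)
    ultimately have ij: "(i, j) \<in> r" "i = j \<longrightarrow> a \<longrightarrow> b" by (simp_all add: doubled_iff)
    show "H y \<subseteq> H x"
    proof (cases "i = j")
      case True
      thus ?thesis using ij GF[of i] xy by (auto simp: H_def)
    next
      case False
      have "H y \<subseteq> F j" "G i \<subseteq> H x" using GF xy by (simp_all add: H_def)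
      thus ?thesis using dec[OF ij(1) False] by blast
    qed
  next
    have "\<Union>{H x - H y |x y. ord_even (doubled r) x \<and> ord_succ (doubled r) x y}
        = (\<Union>i. H (i, False) - H (i, True))"
      unfolding ord_even_doubled[OF r] by blast
    also have "\<dots> = (\<Union>i\<in>{i. F i - G i \<subseteq> E}. F i - G i)"
    proof -
      have "H (i, False) - H (i, True) = (if F i - G i \<subseteq> E then F i - G i else {})" for i
        by (simp add: H_def)
      thus ?thesis by auto
    qed
    also have "\<dots> = E"
    proof (intro equalityI subsetI)
      fix x assume x: "x \<in> E"
      then obtain i where "x \<in> F i - G i" using U assms(1) by blast
      thus "x \<in> (\<Union>i\<in>{i. F i - G i \<subseteq> E}. F i - G i)" using P[of i] x by blast
    qed blast
    finally show "E = \<Union>{H x - H y |x y. ord_even (doubled r) x \<and> ord_succ (doubled r) x y}" ..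
  qed
  thus ?thesis unfolding resolvable_in_def by (rule exI)
qed

text \<open>Let \<open>k\<close> be the least index with \<open>C\<close> not inside
  \<open>F k\<close>. Off \<open>F k\<close>, the only difference that can meet \<open>C\<close> is
  the one ending at \<open>k\<close>, because \<open>C\<close> lies in all earlier sets. If this
  difference belongs to \<open>E\<close>, it contains all of \<open>C - F k\<close>. If there is no
  such \<open>k\<close>, then \<open>C\<close> misses every difference.\<close>

lemma resolvable_in_locally_constant:
  assumes "resolvable_in X E" "C \<subseteq> topspace X" "C \<noteq> {}"
  obtains V where "openin X V" "V \<inter> C \<noteq> {}" "V \<inter> C \<subseteq> E \<or> V \<inter> C \<inter> E = {}"
proof -
  obtain r :: "('a set \<times> bool) rel" and F where r: "Well_order r"
    and cl: "\<And>i. i \<in> Field r \<Longrightarrow> closedin X (F i)"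
    and dec: "\<And>i j. (i, j) \<in> r \<Longrightarrow> F j \<subseteq> F i"
    and E: "E = \<Union>{F i - F j |i j. ord_even r i \<and> ord_succ r i j}"
    using assms(1) unfolding resolvable_in_def resolvable_along_def by blast
  have fld: "i \<in> Field r" "j \<in> Field r" "(i, j) \<in> r" "i \<noteq> j" if "ord_succ r i j" for i j
    using that by (auto simp: ord_succ_def aboveS_def intro: FieldI1 FieldI2)
  have wf: "wf (r - Id)" using r by (simp add: well_order_on_def)
  have tot: "i = j \<or> (i, j) \<in> r - Id \<or> (j, i) \<in> r - Id" if "i \<in> Field r" "j \<in> Field r" for i j
    using r that by (auto simp: well_order_on_def linear_order_on_def total_on_def)
  show ?thesis
  proof (cases "\<forall>i\<in>Field r. C \<subseteq> F i")
    case True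
    hence "C \<inter> E = {}" using fld(2) unfolding E by blast
    thus ?thesis using that[of "topspace X"] assms by (simp add: inf_absorb2)
  next
    case False
    then obtain k0 where "k0 \<in> {i \<in> Field r. \<not> C \<subseteq> F i}" by auto
    from wfE_min[OF wf this] obtain k where k: "k \<in> Field r" "\<not> C \<subseteq> F k"
      and least: "\<And>i. (i, k) \<in> r - Id \<Longrightarrow> i \<in> Field r \<Longrightarrow> C \<subseteq> F i"
      by (metis (mono_tags, lifting) mem_Collect_eq)
    let ?V = "topspace X - F k"
    have "?V \<inter> C \<subseteq> E" if nonempty: "?V \<inter> C \<inter> E \<noteq> {}"
    proof -
      from nonempty obtain x i j where x: "x \<in> C" "x \<notin> F k" "x \<in> F i" "x \<notin> F j"
        and ij: "ord_even r i" "ord_succ r i j"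
        unfolding E by blast
      have "(i, k) \<in> r - Id" using x tot[of i k] fld[OF ij(2)] k dec by blast
      hence "k \<in> aboveS r i" by (auto simp: aboveS_def)
      hence "(j, k) \<in> r" using ij(2) unfolding ord_succ_def by blast
      moreover have "(j, k) \<notin> r - Id" using x least fld[OF ij(2)] by blast
      ultimately have "j = k" by blast
      moreover have "C \<subseteq> F i" using least \<open>(i, k) \<in> r - Id\<close> fld[OF ij(2)] by blast
      ultimately show ?thesis using ij unfolding E by blast
    qed
    moreover have "?V \<inter> C \<noteq> {}" using k assms by blast
    ultimately show ?thesis using that[of ?V] cl k by blast
  qed
qed

section \<open>Separating maps and tame sets\<close>

text \<open>Regularity is applied twice, so that even the closure of the neighbourhood is separated
  from \<open>C\<close> by disjoint open sets. This is the form of input that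
  \<open>irred_separated\<close> takes.\<close>

lemma regular_separation:
  assumes "regular_space Y" "closedin Y C" "y \<in> topspace Y - C"
  obtains U W W' where "openin Y U" "openin Y W" "openin Y W'" "y \<in> U" "Y closure_of U \<subseteq> W"
    "C \<subseteq> W'" "W \<inter> W' = {}"
proof -
  obtain W W' where W: "openin Y W" "openin Y W'" "y \<in> W" "C \<subseteq> W'" "disjnt W W'"
    using assms(1)[unfolded regular_space_def, rule_format, OF conjI[OF assms(2,3)]] by metis
  have "closedin Y (topspace Y - W)" "y \<in> topspace Y - (topspace Y - W)"
    using W assms(3) by auto
  then obtain U where U: "openin Y U" "y \<in> U" "disjnt (topspace Y - W) (Y closure_of U)"
    using assms(1)[unfolded regular_space, rule_format, OF conjI] by metis
  have "Y closure_of U \<subseteq> W" using U(3) closure_of_subset_topspace[of Y U] by (auto simp: disjnt_def)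
  thus ?thesis using that[of U W W'] U W by (auto simp: disjnt_def)
qed

text \<open>The last assumption says that the preimages of two disjoint open sets are never both dense
  in the same nonempty set \<open>T\<close>. It is the only consequence of conditions (i) and (iii) that is used.\<close>

locale separating_map =
  fixes X :: "'a topology" and Y :: "'b topology" and f :: "'a \<Rightarrow> 'b"
  assumes maps: "f \<in> topspace X \<rightarrow> topspace Y"
    and regular: "regular_space Y" and t1: "t1_space Y"
    and separating: "\<And>T W W'. T \<subseteq> topspace X \<Longrightarrow> T \<noteq> {} \<Longrightarrow> openin Y W \<Longrightarrow> openin Y W' \<Longrightarrow>
      W \<inter> W' = {} \<Longrightarrow> \<exists>V. openin X V \<and> V \<inter> T \<noteq> {} \<and> (f ` (V \<inter> T) \<inter> W = {} \<or> f ` (V \<inter> T) \<inter> W' = {})"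
begin

definition cont_on :: "'a set \<Rightarrow> bool" where
  "cont_on T \<longleftrightarrow> (\<forall>t\<in>T. \<forall>W. openin Y W \<and> f t \<in> W \<longrightarrow> (\<exists>V. openin X V \<and> t \<in> V \<and> f ` (V \<inter> T) \<subseteq> W))"

text \<open>\<open>tame Z\<close>: the restriction of \<open>f\<close> to \<open>Z\<close> is weakly discontinuous.\<close>

definition tame :: "'a set \<Rightarrow> bool" where
  "tame Z \<longleftrightarrow> (\<forall>T\<subseteq>Z. T \<noteq> {} \<longrightarrow> (\<exists>V. openin X V \<and> V \<inter> T \<noteq> {} \<and> cont_on (V \<inter> T)))"

text \<open>Wildness near \<open>x\<close> that survives excluding the values in \<open>S\<close>.
  In the inductive construction \<open>S\<close> is the union of the closures of all sets
  \<open>U\<close> chosen so far, and irreducibility of every chosen point is the invariant.\<close>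

definition irred :: "'b set \<Rightarrow> 'a \<Rightarrow> bool" where
  "irred S x \<longleftrightarrow> x \<in> topspace X \<and> (\<forall>V. openin X V \<and> x \<in> V \<longrightarrow> \<not> tame {z \<in> V. f z \<notin> S})"

text \<open>A value \<open>y\<close> is bad if no neighbourhood of it can be excluded without losing
  irreducibility at \<open>x\<close>. At most one value is bad, which leaves enough room to add points one
  by one.\<close>

definition bad :: "'b set \<Rightarrow> 'a \<Rightarrow> 'b \<Rightarrow> bool" where
  "bad S x y \<longleftrightarrow> (\<forall>U. openin Y U \<and> y \<in> U \<longrightarrow> \<not> irred (S \<union> Y closure_of U) x)"

lemma cont_on_mono: "cont_on T \<Longrightarrow> T' \<subseteq> T \<Longrightarrow> cont_on T'"
  unfolding cont_on_def by (meson Int_mono image_mono order_refl subset_iff subset_trans)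

lemma cont_on_constant: "(\<And>t. t \<in> T \<Longrightarrow> f t = y) \<Longrightarrow> T \<subseteq> topspace X \<Longrightarrow> cont_on T"
  unfolding cont_on_def by (metis (no_types, lifting) Int_iff image_subsetI openin_topspace subsetD)

lemma tame_mono: "tame Z \<Longrightarrow> Z' \<subseteq> Z \<Longrightarrow> tame Z'"
  unfolding tame_def by (meson order_trans)

lemma tame_cont_on: "cont_on Z \<Longrightarrow> Z \<subseteq> topspace X \<Longrightarrow> tame Z"
  unfolding tame_def
  by (metis cont_on_mono inf.absorb_iff2 inf_le2 openin_topspace subset_trans)

lemma tame_relative:
  assumes "tame (V \<inter> T)" "openin X V" "V \<inter> T \<noteq> {}"
  shows "\<exists>V. openin X V \<and> V \<inter> T \<noteq> {} \<and> cont_on (V \<inter> T)"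
proof -
  obtain V' where V': "openin X V'" "V' \<inter> (V \<inter> T) \<noteq> {}" "cont_on (V' \<inter> (V \<inter> T))"
    using assms(1)[unfolded tame_def, rule_format, OF subset_refl assms(3)] by metis
  have "V' \<inter> (V \<inter> T) = (V' \<inter> V) \<inter> T" by blast
  moreover have "openin X (V' \<inter> V)" using V' assms(2) by blast
  ultimately show ?thesis using V' by metis
qed

text \<open>By separation some relatively open piece of \<open>T\<close> avoids \<open>W\<close> or
  \<open>W'\<close>. Avoiding \<open>W\<close> excludes \<open>Z - Z'\<close>, and avoiding
  \<open>W'\<close> excludes \<open>Z' - Z\<close>, so the piece lies in one of the two tame
  sets.\<close>

lemma tame_Un_separated:
  assumes Z: "tame Z" "tame Z'" "Z \<union> Z' \<subseteq> topspace X"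
    and W: "openin Y W" "openin Y W'" "W \<inter> W' = {}"
    and dif: "f ` (Z - Z') \<subseteq> W" "f ` (Z' - Z) \<subseteq> W'"
  shows "tame (Z \<union> Z')"
  unfolding tame_def
proof (intro allI impI)
  fix T assume T: "T \<subseteq> Z \<union> Z'" "T \<noteq> {}"
  then obtain V where V: "openin X V" "V \<inter> T \<noteq> {}"
    "f ` (V \<inter> T) \<inter> W = {} \<or> f ` (V \<inter> T) \<inter> W' = {}"
    using separating[of T W W'] Z(3) W by blast
  have "V \<inter> T \<subseteq> Z \<or> V \<inter> T \<subseteq> Z'" using V(3) dif T(1) by blast
  hence "tame (V \<inter> T)" using Z tame_mono by blast
  thus "\<exists>V. openin X V \<and> V \<inter> T \<noteq> {} \<and> cont_on (V \<inter> T)"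
    using V by (intro tame_relative)
qed

text \<open>On the fibre \<open>f\<close> is constant. Near a continuity point of the tame part with
  value other than \<open>y\<close>, separation isolates a piece lying in the fibre or in
  \<open>Z\<close>.\<close>

lemma tame_Un_fibre:
  assumes Z: "tame Z" "Z \<subseteq> topspace X"
  shows "tame (Z \<union> {x \<in> topspace X. f x = y})"
  unfolding tame_def
proof (intro allI impI)
  fix T assume T: "T \<subseteq> Z \<union> {x \<in> topspace X. f x = y}" "T \<noteq> {}"
  let ?thesis = "\<exists>V. openin X V \<and> V \<inter> T \<noteq> {} \<and> cont_on (V \<inter> T)"
  have TX: "T \<subseteq> topspace X" using T Z by blast
  show ?thesis
  proof (cases "T \<inter> Z = {}")
    case True
    hence "cont_on (topspace X \<inter> T)" using T by (intro cont_on_constant[of _ y]) auto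
    moreover have "topspace X \<inter> T \<noteq> {}" using TX T(2) by blast
    ultimately show ?thesis by blast
  next
    case False
    then obtain V where V: "openin X V" "V \<inter> (T \<inter> Z) \<noteq> {}" "cont_on (V \<inter> (T \<inter> Z))"
      using Z unfolding tame_def by (metis inf_le2)
    show ?thesis
    proof (cases "\<exists>t\<in>V \<inter> T \<inter> Z. f t \<noteq> y")
      case False
      hence "cont_on (V \<inter> T)" using T TX by (intro cont_on_constant[of _ y]) auto
      thus ?thesis using V by blast
    next
      case True
      then obtain t where t: "t \<in> V \<inter> T \<inter> Z" "f t \<noteq> y" by blast
      show ?thesis
      proof (cases "y \<in> topspace Y")
        case False
        hence "{x \<in> topspace X. f x = y} = {}" using maps by blast
        hence "V \<inter> T = V \<inter> (T \<inter> Z)" using T by blast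
        thus ?thesis using V by metis
      next
        case True
        have "Hausdorff_space Y" using regular t1 regular_t1_imp_Hausdorff_space by blast
        moreover have "f t \<in> topspace Y" using t TX maps by blast
        ultimately obtain W W' where W: "openin Y W" "openin Y W'" "f t \<in> W" "y \<in> W'" "W \<inter> W' = {}"
          using True t(2) unfolding Hausdorff_space_def disjnt_def by metis
        have "t \<in> V \<inter> (T \<inter> Z)" using t by blast
        \<comment> \<open>Inside \<open>D\<close> the points coming from \<open>Z\<close> have
          values in \<open>W\<close>. A piece avoiding \<open>W\<close> therefore lies in the fibre,
          while a piece avoiding \<open>W'\<close> contains no point of the fibre.\<close>
        then obtain D where D: "openin X D" "t \<in> D" "f ` (D \<inter> (V \<inter> (T \<inter> Z))) \<subseteq> W"
          using V(3) W(1,3) unfolding cont_on_def by blast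
        let ?T = "D \<inter> V \<inter> T"
        have "?T \<subseteq> topspace X" "?T \<noteq> {}" using TX D t by blast+
        then obtain V' where V': "openin X V'" "V' \<inter> ?T \<noteq> {}"
          "f ` (V' \<inter> ?T) \<inter> W = {} \<or> f ` (V' \<inter> ?T) \<inter> W' = {}"
          using separating[of ?T W W'] W by blast
        have "cont_on (V' \<inter> ?T)"
          using V'(3)
        proof
          assume "f ` (V' \<inter> ?T) \<inter> W = {}"
          hence "f x = y" if "x \<in> V' \<inter> ?T" for x using that D(3) T(1) by blast
          moreover have "V' \<inter> ?T \<subseteq> topspace X" using TX by blast
          ultimately show ?thesis by (rule cont_on_constant)
        next
          assume "f ` (V' \<inter> ?T) \<inter> W' = {}"
          hence "V' \<inter> ?T \<subseteq> V \<inter> (T \<inter> Z)" using W(4) T(1) by blast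
          thus ?thesis using V(3) cont_on_mono by blast
        qed
        moreover have "V' \<inter> ?T = (V' \<inter> D \<inter> V) \<inter> T" by blast
        moreover have "openin X (V' \<inter> D \<inter> V)" using V V' D by blast
        ultimately show ?thesis using V'(2) by metis
      qed
    qed
  qed
qed

lemma tame_Un_finite_fibres:
  assumes "finite B" "tame Z" "Z \<subseteq> topspace X"
  shows "tame (Z \<union> {x \<in> topspace X. f x \<in> B})"
  using assms(1)
proof induction
  case empty
  thus ?case using assms by simp
next
  case (insert y B)
  have "Z \<union> {x \<in> topspace X. f x \<in> insert y B}
      = (Z \<union> {x \<in> topspace X. f x \<in> B}) \<union> {x \<in> topspace X. f x = y}" by blast
  thus ?case using insert tame_Un_fibre assms(3) by simp
qed

section \<open>Irreducible points and bad values\<close>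

text \<open>If both exclusions failed, then on a common neighbourhood the two remaining sets would
  be tame. They differ only in points with values in \<open>A\<close> or \<open>A'\<close>, so
  \<open>tame_Un_separated\<close> makes their union tame, and this union is all that
  \<open>S\<close> leaves.\<close>

lemma irred_separated:
  assumes x: "irred S x" and W: "openin Y W" "openin Y W'" "W \<inter> W' = {}" "A \<subseteq> W" "A' \<subseteq> W'"
  shows "irred (S \<union> A) x \<or> irred (S \<union> A') x"
proof (rule ccontr)
  assume "\<not> ?thesis"
  then obtain V V' where V: "openin X V" "x \<in> V" "tame {z \<in> V. f z \<notin> S \<union> A}"
    and V': "openin X V'" "x \<in> V'" "tame {z \<in> V'. f z \<notin> S \<union> A'}"
    using x unfolding irred_def by blast
  let ?Z = "{z \<in> V \<inter> V'. f z \<notin> S \<union> A'}" and ?Z' = "{z \<in> V \<inter> V'. f z \<notin> S \<union> A}"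
  have "tame ?Z" by (rule tame_mono[OF V'(3)]) blast
  moreover have "tame ?Z'" by (rule tame_mono[OF V(3)]) blast
  ultimately have "tame (?Z \<union> ?Z')"
    by (rule tame_Un_separated[OF _ _ _ W(1-3)]) (use openin_subset[OF V(1)] W in auto)
  moreover have "?Z \<union> ?Z' = {z \<in> V \<inter> V'. f z \<notin> S}" using W by blast
  ultimately have "tame {z \<in> V \<inter> V'. f z \<notin> S}" by simp
  moreover have "openin X (V \<inter> V')" "x \<in> V \<inter> V'" using V V' by auto
  ultimately show False using x unfolding irred_def by blast
qed

lemma irred_anti_mono: "irred S x \<Longrightarrow> S' \<subseteq> S \<Longrightarrow> irred S' x"
  unfolding irred_def by (smt (verit) Collect_mono_iff subset_iff tame_mono)

text \<open>Distinct values have neighbourhoods whose closures lie in disjoint open sets, and by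
  \<open>irred_separated\<close> one of these closures can be excluded.\<close>

lemma bad_unique:
  assumes "irred S x" "bad S x y" "bad S x y'" "y \<in> topspace Y" "y' \<in> topspace Y"
  shows "y = y'"
proof (rule ccontr)
  assume "y \<noteq> y'"
  hence "closedin Y {y'}" "y \<in> topspace Y - {y'}"
    using t1 assms by (auto simp: closedin_t1_singleton)
  then obtain U W W' where U: "openin Y U" "openin Y W" "openin Y W'" "y \<in> U" "Y closure_of U \<subseteq> W"
    "{y'} \<subseteq> W'" "W \<inter> W' = {}" using regular_separation[OF regular] by metis
  have "closedin Y (topspace Y - W')" "y' \<in> topspace Y - (topspace Y - W')"
    using U assms by auto
  then obtain U' where U': "openin Y U'" "y' \<in> U'" "disjnt (topspace Y - W') (Y closure_of U')"
    using regular unfolding regular_space by blast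
  have "Y closure_of U' \<subseteq> W'"
    using U'(3) closure_of_subset_topspace[of Y U'] by (auto simp: disjnt_def)
  with irred_separated[OF assms(1) U(2,3,7,5)]
  show False using U U' assms(2,3) unfolding bad_def by blast
qed

text \<open>If excluding the closure of \<open>U\<close> destroys irreducibility at
  \<open>z\<close>, it does so throughout a neighbourhood \<open>V\<close>. A point \<open>x\<close>
  of \<open>V\<close> in the set with value outside that closure could then have a neighbourhood of
  \<open>f x\<close> excluded instead, so \<open>f x\<close> would not be bad.\<close>

lemma cont_on_irred_bad: "cont_on {z. irred S z \<and> f z \<notin> S \<and> bad S z (f z)}" (is "cont_on ?N")
  unfolding cont_on_def
proof (intro ballI allI impI)
  fix z D assume z: "z \<in> ?N" and D: "openin Y D \<and> f z \<in> D"
  hence fz: "f z \<in> topspace Y - (topspace Y - D)" "closedin Y (topspace Y - D)"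
    using openin_subset by auto
  then obtain U where U: "openin Y U" "f z \<in> U" "disjnt (topspace Y - D) (Y closure_of U)"
    using regular unfolding regular_space by blast
  have UO: "Y closure_of U \<subseteq> D"
    using U(3) closure_of_subset_topspace[of Y U] by (auto simp: disjnt_def)
  have "\<not> irred (S \<union> Y closure_of U) z" using z U unfolding bad_def by blast
  then obtain V where V: "openin X V" "z \<in> V" "tame {x \<in> V. f x \<notin> S \<union> Y closure_of U}"
    using z unfolding irred_def by blast
  have "f x \<in> Y closure_of U" if x: "x \<in> V" "x \<in> ?N" for x
  proof (rule ccontr)
    assume "f x \<notin> Y closure_of U"
    moreover have "f x \<in> topspace Y" using x maps unfolding irred_def by blast
    ultimately obtain U' W W' where U': "openin Y U'" "openin Y W" "openin Y W'" "f x \<in> U'"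
      "Y closure_of U' \<subseteq> W" "Y closure_of U \<subseteq> W'" "W \<inter> W' = {}"
      using regular_separation[OF regular closedin_closure_of, of "f x" U] by blast
    have "\<not> irred (S \<union> Y closure_of U) x" using V x unfolding irred_def by blast
    hence "irred (S \<union> Y closure_of U') x"
      using irred_separated[OF _ U'(2,3,7,5,6)] x by blast
    thus False using x U' unfolding bad_def by blast
  qed
  thus "\<exists>V. openin X V \<and> z \<in> V \<and> f ` (V \<inter> ?N) \<subseteq> D" using V UO by blast
qed

text \<open>The points of \<open>V\<close> with values outside \<open>S\<close> that are unsuitable
  as \<open>p\<close> are of three kinds: not irreducible, so locally tame; irreducible with their
  own value bad, where \<open>cont_on_irred_bad\<close> applies; or lying over the finitely many
  values bad for some point of \<open>Q\<close>. If nothing else were left, the whole set would be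
  tame.\<close>

lemma irred_extend:
  assumes V: "openin X V" "\<not> tame {z \<in> V. f z \<notin> S}" and S: "closedin Y S"
    and Q: "finite Q" "\<And>q. q \<in> Q \<Longrightarrow> irred S q"
  obtains p U where "p \<in> V" "openin Y U" "f p \<in> U" "U \<inter> S = {}"
    "\<And>q. q \<in> insert p Q \<Longrightarrow> irred (S \<union> Y closure_of U) q"
proof -
  let ?Z = "{z \<in> V. f z \<notin> S}"
  have VX: "V \<subseteq> topspace X" using V openin_subset by blast
  define B where "B = {y \<in> topspace Y. \<exists>q\<in>Q. bad S q y}"
  have "finite {y \<in> topspace Y. bad S q y}" if "q \<in> Q" for q
  proof -
    have "\<exists>y. {y \<in> topspace Y. bad S q y} \<subseteq> {y}"
      using bad_unique[OF Q(2)[OF that]] by (cases "\<exists>y\<in>topspace Y. bad S q y") auto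
    thus ?thesis using finite_subset by blast
  qed
  moreover have "B = (\<Union>q\<in>Q. {y \<in> topspace Y. bad S q y})" unfolding B_def by blast
  ultimately have finB: "finite B" using Q(1) by simp
  have "\<exists>p\<in>V. f p \<notin> S \<and> irred S p \<and> \<not> bad S p (f p) \<and> f p \<notin> B"
  proof (rule ccontr)
    assume no: "\<not> ?thesis"
    let ?N = "{z. irred S z \<and> f z \<notin> S \<and> bad S z (f z)}"
    have "?N \<subseteq> topspace X" unfolding irred_def by blast
    hence "tame (?N \<union> {x \<in> topspace X. f x \<in> B})"
      using tame_Un_finite_fibres[OF finB] tame_cont_on[OF cont_on_irred_bad] by blast
    moreover have "{z \<in> ?Z. irred S z} \<subseteq> ?N \<union> {x \<in> topspace X. f x \<in> B}" using no VX by blast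
    ultimately have irr: "tame {z \<in> ?Z. irred S z}" by (rule tame_mono)
    have "tame ?Z"
      unfolding tame_def
    proof (intro allI impI)
      fix T assume T: "T \<subseteq> ?Z" "T \<noteq> {}"
      show "\<exists>V. openin X V \<and> V \<inter> T \<noteq> {} \<and> cont_on (V \<inter> T)"
      proof (cases "\<forall>z\<in>T. irred S z")
        case True
        hence "T \<subseteq> {z \<in> ?Z. irred S z}" using T by blast
        thus ?thesis using irr T unfolding tame_def by blast
      next
        case False
        then obtain z where zT: "z \<in> T" "\<not> irred S z" by blast
        moreover have "z \<in> topspace X" using zT T VX by auto
        ultimately obtain V' where z: "openin X V'" "z \<in> V'" "tame {z \<in> V'. f z \<notin> S}"
          unfolding irred_def by auto
        have "V' \<inter> T \<subseteq> {z \<in> V'. f z \<notin> S}" "V' \<inter> T \<noteq> {}" using T z zT by auto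
        thus ?thesis using z tame_mono tame_relative by metis
      qed
    qed
    thus False using V by blast
  qed
  then obtain p where p: "p \<in> V" "f p \<notin> S" "irred S p" "\<not> bad S p (f p)" "f p \<notin> B" by blast
  have fp: "f p \<in> topspace Y" using p(1) VX maps by blast
  have "\<exists>U. openin Y U \<and> f p \<in> U \<and> irred (S \<union> Y closure_of U) q" if "q \<in> insert p Q" for q
    using that p fp unfolding B_def bad_def by blast
  then obtain U where U: "\<And>q. q \<in> insert p Q \<Longrightarrow> openin Y (U q) \<and> f p \<in> U q \<and> irred (S \<union> Y closure_of (U q)) q"
    by metis
  \<comment> \<open>Finitely many neighbourhoods, one for each point, are intersected; shrinking
    preserves irreducibility. Removing \<open>S\<close> makes the new set disjoint from it.\<close>
  let ?U = "(topspace Y - S) \<inter> (\<Inter>q\<in>insert p Q. U q)"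
  show ?thesis
  proof
    show "openin Y ?U" using U Q(1) S by (intro openin_Int openin_INT2) auto
    show "p \<in> V" by fact
    show "f p \<in> ?U" using U p fp by blast
    show "?U \<inter> S = {}" by blast
    fix q assume q: "q \<in> insert p Q"
    hence "Y closure_of ?U \<subseteq> Y closure_of (U q)" by (intro closure_of_mono) blast
    thus "irred (S \<union> Y closure_of ?U) q" using U[OF q] irred_anti_mono by (meson Un_mono subset_refl)
  qed
qed

end

section \<open>Baire category and preimages under piecewise continuous maps\<close>

text \<open>Otherwise both sets are dense in \<open>T\<close>, so every open set containing one of
  them is dense in the closure of \<open>T\<close>. That closure is a Baire space, but the countably
  many open sets defining \<open>G\<close> and \<open>G'\<close> have empty intersection.\<close>

lemma completely_Baire_separates_gdelta:
  assumes X: "completely_Baire_space X" and G: "gdelta_in X G" "gdelta_in X G'" "G \<inter> G' = {}"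
    and T: "T \<subseteq> topspace X" "T \<noteq> {}"
  shows "\<exists>V. openin X V \<and> V \<inter> T \<noteq> {} \<and> (V \<inter> T \<inter> G = {} \<or> V \<inter> T \<inter> G' = {})"
proof (rule ccontr)
  assume no: "\<not> ?thesis"
  obtain D D' :: "nat \<Rightarrow> 'a set" where D: "\<And>n. openin X (D n)" "\<Inter>(range D) = G"
    and D': "\<And>n. openin X (D' n)" "\<Inter>(range D') = G'"
    using G(1,2) unfolding gdelta_in_descending by metis
  let ?C = "X closure_of T"
  let ?Z = "subtopology X ?C"
  have C: "topspace ?Z = ?C" "T \<subseteq> ?C" "closedin X ?C"
    using closure_of_subset[OF T(1)] closure_of_subset_topspace[of X T] by auto
  have dense: "openin ?Z (U \<inter> ?C) \<and> ?Z closure_of (U \<inter> ?C) = topspace ?Z"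
    if U: "openin X U" "G \<subseteq> U \<or> G' \<subseteq> U" for U
  proof
    show "openin ?Z (U \<inter> ?C)" using U(1) by (auto simp: openin_subtopology)
    have "x \<in> ?Z closure_of (U \<inter> ?C)" if x: "x \<in> ?C" for x
      unfolding in_closure_of
    proof (intro conjI allI impI)
      show "x \<in> topspace ?Z" using x C by simp
      fix N assume N: "x \<in> N \<and> openin ?Z N"
      then obtain V where V: "openin X V" "N = V \<inter> ?C" by (auto simp: openin_subtopology)
      hence "V \<inter> T \<noteq> {}" using x N unfolding in_closure_of by blast
      hence "V \<inter> T \<inter> G \<noteq> {}" "V \<inter> T \<inter> G' \<noteq> {}" using no V(1) by auto
      thus "\<exists>y. y \<in> U \<inter> ?C \<and> y \<in> N" using U(2) V C(2) by blast
    qed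
    thus "?Z closure_of (U \<inter> ?C) = topspace ?Z"
      using closure_of_subset_topspace[of ?Z] C(1) by blast
  qed
  let ?F = "range (\<lambda>n. D n \<inter> ?C) \<union> range (\<lambda>n. D' n \<inter> ?C)"
  have "countable ?F" by simp
  moreover have "\<forall>U\<in>?F. openin ?Z U \<and> ?Z closure_of U = topspace ?Z"
    using dense D D' by blast
  ultimately have "?Z closure_of (topspace ?Z \<inter> \<Inter>?F) = topspace ?Z"
    using X C(3) unfolding completely_Baire_space_def Baire_space_def by blast
  moreover have "\<Inter>?F \<subseteq> G \<inter> G'" using D D' by blast
  hence "topspace ?Z \<inter> \<Inter>?F = {}" using G(3) by blast
  ultimately show False using C T by simp
qed

text \<open>On each closed piece the preimage of \<open>U\<close> is the trace of an open set, which
  is an F-sigma set by metrizability, and the preimage of the complement is closed. Countable unions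
  stay F-sigma; complements give both claims.\<close>

lemma piecewise_continuous_preimage:
  assumes X: "metrizable_space X" and f: "piecewise_continuous X Y f" "f \<in> topspace X \<rightarrow> topspace Y"
    and U: "openin Y U"
  shows "gdelta_in X {x \<in> topspace X. f x \<in> U}" "gdelta_in X {x \<in> topspace X. f x \<notin> U}"
proof -
  obtain C :: "nat \<Rightarrow> 'a set" where C: "\<And>n. closedin X (C n)" "(\<Union>n. C n) = topspace X"
    "\<And>n. continuous_map (subtopology X (C n)) Y f"
    using f unfolding piecewise_continuous_def by blast
  have CX: "C n \<subseteq> topspace X" for n using C(1) closedin_subset by blast
  have "fsigma_in X {x \<in> C n. f x \<in> U}" for n
  proof -
    have "{x \<in> topspace (subtopology X (C n)). f x \<in> U} = {x \<in> C n. f x \<in> U}" using CX by auto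
    hence "openin (subtopology X (C n)) {x \<in> C n. f x \<in> U}"
      using openin_continuous_map_preimage[OF C(3) U, of n] by simp
    then obtain V where V: "openin X V" "{x \<in> C n. f x \<in> U} = V \<inter> C n"
      by (auto simp: openin_subtopology)
    show ?thesis
      unfolding V(2) by (intro fsigma_in_Int open_imp_fsigma_in[OF X V(1)] closed_imp_fsigma_in C(1))
  qed
  hence "fsigma_in X (\<Union>n. {x \<in> C n. f x \<in> U})" by (intro fsigma_in_Union) auto
  moreover have "(\<Union>n. {x \<in> C n. f x \<in> U}) = topspace X - {x \<in> topspace X. f x \<notin> U}"
    using C(2) by blast
  ultimately show "gdelta_in X {x \<in> topspace X. f x \<notin> U}"
    unfolding gdelta_in_fsigma_in by auto
  have "fsigma_in X {x \<in> C n. f x \<in> topspace Y - U}" for n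
  proof -
    have "{x \<in> topspace (subtopology X (C n)). f x \<in> topspace Y - U} = {x \<in> C n. f x \<in> topspace Y - U}"
      using CX by auto
    moreover have "closedin Y (topspace Y - U)" using U by blast
    ultimately have "closedin (subtopology X (C n)) {x \<in> C n. f x \<in> topspace Y - U}"
      using closedin_continuous_map_preimage[OF C(3), of "topspace Y - U" n] by simp
    hence "closedin X {x \<in> C n. f x \<in> topspace Y - U}"
      using C(1) closedin_closed_subtopology by blast
    thus ?thesis by (rule closed_imp_fsigma_in)
  qed
  hence "fsigma_in X (\<Union>n. {x \<in> C n. f x \<in> topspace Y - U})" by (intro fsigma_in_Union) auto
  moreover have "(\<Union>n. {x \<in> C n. f x \<in> topspace Y - U}) = topspace X - {x \<in> topspace X. f x \<in> U}"
    using C(2) f(2) by blast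
  ultimately show "gdelta_in X {x \<in> topspace X. f x \<in> U}"
    unfolding gdelta_in_fsigma_in by auto
qed

section \<open>From weak discontinuity to piecewise continuity\<close>

context separating_map
begin

lemma cont_on_continuous_map:
  assumes "T \<subseteq> topspace X" "cont_on T"
  shows "continuous_map (subtopology X T) Y f"
  unfolding continuous_map_eq_topcontinuous_at topcontinuous_at_def
proof (intro ballI conjI allI impI)
  fix x assume x: "x \<in> topspace (subtopology X T)"
  thus "x \<in> topspace (subtopology X T)" .
  show "f \<in> topspace (subtopology X T) \<rightarrow> topspace Y" using maps by auto
  fix W assume "openin Y W \<and> f x \<in> W"
  then obtain V where V: "openin X V" "x \<in> V" "f ` (V \<inter> T) \<subseteq> W"
    using assms(2)[unfolded cont_on_def, rule_format, of x W] x by auto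
  have "openin (subtopology X T) (V \<inter> T)" using V by (auto simp: openin_subtopology)
  thus "\<exists>U. openin (subtopology X T) U \<and> x \<in> U \<and> (\<forall>y\<in>U. f y \<in> W)"
    using V x by (intro exI[of _ "V \<inter> T"]) auto
qed

lemma tame_imp_piecewise_continuous:
  assumes "metrizable_space X" "tame (topspace X)"
  shows "piecewise_continuous X Y f"
proof -
  obtain M d where Md: "Metric_space M d" "X = Metric_space.mtopology M d"
    using assms(1) unfolding metrizable_space_def by blast
  interpret Metric_space M d by (rule Md)
  have X: "X = mtopology" "topspace X = M" using Md by simp_all
  have pieces: "\<exists>V. openin X V \<and> V \<inter> C \<noteq> {} \<and> cont_on (V \<inter> C)" if "closedin X C" "C \<noteq> {}" for C
    using assms(2) that closedin_subset unfolding tame_def by blast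
  have empty: "cont_on {}" unfolding cont_on_def by blast
  obtain r :: "'a set rel" and F G where r: "Well_order r" "Field r = UNIV"
    and cl: "\<And>i. closedin X (F i)" "\<And>i. closedin X (G i)" and GF: "\<And>i. G i \<subseteq> F i"
    and P: "\<And>i. cont_on (F i - G i)"
    and dec: "\<And>i j. (i, j) \<in> r \<Longrightarrow> i \<noteq> j \<Longrightarrow> F j \<subseteq> G i" and U: "(\<Union>i. F i - G i) = topspace X"
    by (rule transfinite_derivative[of X cont_on, OF pieces])
      (assumption, assumption, rule empty, (rule that; assumption))
  have FM: "F i \<subseteq> M" "G i \<subseteq> M" for i using cl closedin_subset X by blast+
  define e where "e n = 1 / real (Suc n)" for n
  have e: "e n > 0" for n by (simp add: e_def)
  \<comment> \<open>For fixed \<open>n\<close> the sets \<open>K n i\<close> have mutual distance at least \<open>e n\<close>, so their union is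
    closed and \<open>f\<close> is continuous on it.\<close>
  define K where "K n i = {x \<in> F i. \<forall>y\<in>G i. e n \<le> d x y}" for n i
  have K: "K n i \<subseteq> F i - G i" for n i using e[of n] FM by (force simp: K_def)
  have apart: "i = j" if "x \<in> K n i" "y \<in> K n j" "d x y < e n" for n i j x y
  proof (rule ccontr)
    assume "i \<noteq> j"
    hence "(i, j) \<in> r \<or> (j, i) \<in> r"
      using r by (auto simp: well_order_on_def linear_order_on_def total_on_def)
    \<comment> \<open>The later stage lies in the set \<open>G\<close> of the earlier one, from
      which the points of \<open>K\<close> keep distance at least \<open>e n\<close>.\<close>
    hence "F j \<subseteq> G i \<or> F i \<subseteq> G j" using dec \<open>i \<noteq> j\<close> by blast
    hence "y \<in> G i \<or> x \<in> G j" using that unfolding K_def by blast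
    thus False using that(1,2,3) commute[of x y] unfolding K_def by force
  qed
  define C where "C n = (\<Union>i. K n i)" for n
  have CM: "C n \<subseteq> M" for n using K FM unfolding C_def by blast
  have "closedin X (C n)" for n
  proof -
    have "x \<in> C n" if x: "x \<in> mtopology closure_of C n" for x
    proof -
      have xM: "x \<in> M" and near: "\<And>\<delta>. \<delta> > 0 \<Longrightarrow> \<exists>y\<in>C n. y \<in> mball x \<delta>"
        using x unfolding metric_closure_of by auto
      \<comment> \<open>With radius \<open>e n / 2\<close>, all points of \<open>C n\<close> this
        close to \<open>x\<close> come from a single \<open>K n i\<close>, so \<open>x\<close> is a
        limit of that one set.\<close>
      obtain y i where y: "y \<in> K n i" "y \<in> mball x (e n / 2)"
        using near[of "e n / 2"] e unfolding C_def by auto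
      have near': "\<exists>z\<in>K n i. z \<in> mball x \<delta>" if \<delta>: "\<delta> > 0" for \<delta>
      proof -
        obtain z j where z: "z \<in> K n j" "z \<in> mball x (min \<delta> (e n / 2))"
          using near[of "min \<delta> (e n / 2)"] e \<delta> unfolding C_def by auto
        have "d y z < e n"
          using y z triangle[of y x z] commute[of x y] by auto
        hence "i = j" using apart y z by blast
        thus ?thesis using z by auto
      qed
      hence "x \<in> mtopology closure_of F i"
        using xM K unfolding metric_closure_of by blast
      hence "x \<in> F i" using cl X by (metis closure_of_closedin)
      moreover have "e n \<le> d x g" if g: "g \<in> G i" for g
      proof (rule field_le_epsilon)
        fix \<delta> :: real assume "\<delta> > 0"
        then obtain z where z: "z \<in> K n i" "z \<in> mball x \<delta>" using near' by blast
        hence "e n \<le> d z g" using g unfolding K_def by blast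
        also have "\<dots> \<le> d z x + d x g" using z g FM xM by (intro triangle) auto
        finally show "e n \<le> d x g + \<delta>" using z commute[of x z] by auto
      qed
      ultimately show ?thesis unfolding C_def K_def by blast
    qed
    hence "mtopology closure_of C n \<subseteq> C n" by blast
    thus ?thesis using closure_of_subset_eq[of "C n" mtopology] CM X by simp
  qed
  moreover have "continuous_map (subtopology X (C n)) Y f" for n
  proof (rule cont_on_continuous_map)
    show "C n \<subseteq> topspace X" using CM X by simp
    show "cont_on (C n)"
      unfolding cont_on_def
    proof (intro ballI allI impI)
      fix t W assume t: "t \<in> C n" and W: "openin Y W \<and> f t \<in> W"
      then obtain i where i: "t \<in> K n i" unfolding C_def by blast
      hence "t \<in> F i - G i" using K by blast
      then obtain V where V: "openin X V" "t \<in> V" "f ` (V \<inter> (F i - G i)) \<subseteq> W"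
        using P[of i] W unfolding cont_on_def by blast
      have "mball t (e n) \<inter> C n \<subseteq> F i - G i"
      proof
        fix z assume z: "z \<in> mball t (e n) \<inter> C n"
        then obtain j where "z \<in> K n j" unfolding C_def by blast
        moreover from this have "i = j" using apart[OF i] z by auto
        ultimately show "z \<in> F i - G i" using K by blast
      qed
      hence "f ` (V \<inter> mball t (e n) \<inter> C n) \<subseteq> W" using V by blast
      moreover have "openin X (V \<inter> mball t (e n))" using V X by auto
      moreover have "t \<in> M" using t CM by blast
      hence "t \<in> V \<inter> mball t (e n)" using V e by simp
      ultimately show "\<exists>V. openin X V \<and> t \<in> V \<and> f ` (V \<inter> C n) \<subseteq> W" by blast
    qed
  qed
  moreover have "(\<Union>n. C n) = topspace X"
  proof
    show "(\<Union>n. C n) \<subseteq> topspace X" using CM X by blast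
    show "topspace X \<subseteq> (\<Union>n. C n)"
    proof
      fix x assume "x \<in> topspace X"
      then obtain i where i: "x \<in> F i - G i" using U by blast
      have "openin mtopology (topspace X - G i)" using cl X by auto
      moreover have "x \<in> topspace X - G i" using i FM X by auto
      ultimately obtain \<delta> where \<delta>: "\<delta> > 0" "mball x \<delta> \<subseteq> topspace X - G i"
        unfolding openin_mtopology by blast
      obtain n where n: "e n < \<delta>" using reals_Archimedean[OF \<delta>(1)] by (auto simp: e_def inverse_eq_divide)
      have "e n \<le> d x y" if "y \<in> G i" for y
      proof (rule ccontr)
        assume "\<not> e n \<le> d x y"
        hence "y \<in> mball x \<delta>" using n i that FM by auto
        thus False using \<delta>(2) that by blast
      qed
      thus "x \<in> (\<Union>n. C n)" using i unfolding C_def K_def by blast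
    qed
  qed
  ultimately show ?thesis unfolding piecewise_continuous_def by blast
qed

section \<open>Inductive construction against wildness\<close>

lemma tame_topspace:
  assumes "metrizable_space X"
  shows "tame (topspace X)"
proof (rule ccontr)
  assume wild: "\<not> tame (topspace X)"
  obtain M d where Md: "Metric_space M d" "X = Metric_space.mtopology M d"
    using assms(1) unfolding metrizable_space_def by blast
  interpret Metric_space M d by (rule Md)
  have X: "X = mtopology" "topspace X = M" using Md by simp_all
  \<comment> \<open>Every \<open>i\<close> equals \<open>a n\<close> for infinitely many even and infinitely many odd \<open>n\<close>;
    the parity of \<open>n\<close> is the colour of the point \<open>p (Suc n)\<close>, chosen near \<open>p (a n)\<close>.\<close>
  define a where "a n = fst (prod_decode (n div 2))" for n
  have a: "a n \<le> n" for n
    using le_prod_encode_1[of "a n" "snd (prod_decode (n div 2))"] by (simp add: a_def)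
  define S where "S n U = (\<Union>j\<le>n. Y closure_of (U j))" for n :: nat and U :: "nat \<Rightarrow> 'b set"
  \<comment> \<open>A state is a pair of infinite sequences of which only the entries up to
    \<open>n\<close> matter. \<open>I\<close> is the invariant; \<open>R\<close> says that the next
    state keeps these entries and puts the new point close to \<open>p (a n)\<close>.\<close>
  define I where "I n = (\<lambda>(p, U). (\<forall>i\<le>n. p i \<in> M \<and> openin Y (U i) \<and> f (p i) \<in> U i \<and> irred (S n U) (p i))
    \<and> (\<forall>i j. i < j \<and> j \<le> n \<longrightarrow> U i \<inter> U j = {}))" for n
  define R where "R n = (\<lambda>(p, U :: nat \<Rightarrow> 'b set) (p', U'). (\<forall>i\<le>n. p' i = p i \<and> U' i = U i)
    \<and> d (p (a n)) (p' (Suc n)) < 1 / real (Suc n))" for n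
  have base: "\<exists>s. I 0 s"
  proof -
    obtain p U where "p \<in> topspace X" "openin Y U" "f p \<in> U"
      "\<And>q. q \<in> insert p {} \<Longrightarrow> irred ({} \<union> Y closure_of U) q"
      using irred_extend[of "topspace X" "{}" "{}"] wild by auto
    hence "I 0 (\<lambda>_. p, \<lambda>_. U)" using X by (simp add: I_def S_def)
    thus ?thesis ..
  qed
  have step: "\<exists>s'. I (Suc n) s' \<and> R n s s'" if "I n s" for n s
  proof -
    obtain p U where s: "s = (p, U)" by (cases s)
    have I: "p i \<in> M" "openin Y (U i)" "f (p i) \<in> U i" "irred (S n U) (p i)" if "i \<le> n" for i
      using \<open>I n s\<close> that by (auto simp: I_def s)
    have disj: "U i \<inter> U j = {}" if "i < j" "j \<le> n" for i j
      using \<open>I n s\<close> that by (auto simp: I_def s)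
    let ?V = "mball (p (a n)) (1 / real (Suc n))"
    have V: "openin X ?V" "p (a n) \<in> ?V" using X I(1) a by auto
    hence wildV: "\<not> tame {z \<in> ?V. f z \<notin> S n U}" using I(4)[OF a] unfolding irred_def by blast
    have clS: "closedin Y (S n U)" unfolding S_def by (intro closedin_Union) auto
    have Q: "finite (p ` {..n})" "\<And>q. q \<in> p ` {..n} \<Longrightarrow> irred (S n U) q" using I(4) by auto
    obtain q W where q: "q \<in> ?V" "openin Y W" "f q \<in> W" "W \<inter> S n U = {}"
      "\<And>x. x \<in> insert q (p ` {..n}) \<Longrightarrow> irred (S n U \<union> Y closure_of W) x"
      by (rule irred_extend[OF V(1) wildV clS Q]) (assumption, (rule that; assumption))
    let ?p = "p(Suc n := q)" and ?U = "U(Suc n := W)"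
    have "S (Suc n) ?U = S n U \<union> Y closure_of W" by (auto simp: S_def atMost_Suc)
    hence "irred (S (Suc n) ?U) (?p i)" if "i \<le> Suc n" for i using q(5) that by auto
    moreover have "?U i \<inter> ?U j = {}" if "i < j" "j \<le> Suc n" for i j
    proof (cases "j = Suc n")
      case True
      have i: "i \<le> n" using that True by simp
      hence "U i \<subseteq> Y closure_of U i" by (intro closure_of_subset openin_subset I(2))
      hence "U i \<subseteq> S n U" using i unfolding S_def by blast
      thus ?thesis using q(4) that True by auto
    next
      case False
      thus ?thesis using disj that by auto
    qed
    moreover have "?p i \<in> M \<and> openin Y (?U i) \<and> f (?p i) \<in> ?U i" if "i \<le> Suc n" for i
      using I[of i] q(1-3) that by (cases "i = Suc n") auto
    ultimately have "I (Suc n) (?p, ?U)" unfolding I_def prod.case by blast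
    moreover have "R n s (?p, ?U)" using q(1) by (auto simp: R_def s)
    ultimately show ?thesis by blast
  qed
  obtain \<sigma> where \<sigma>: "\<And>n. I n (\<sigma> n)" "\<And>n. R n (\<sigma> n) (\<sigma> (Suc n))"
    using dependent_nat_choice[of I R] base step by metis
  \<comment> \<open>The entries up to \<open>n\<close> never change after stage \<open>n\<close>, so
    the diagonal carries all the information.\<close>
  define p where "p n = fst (\<sigma> n) n" for n
  define U where "U n = snd (\<sigma> n) n" for n
  have stable: "fst (\<sigma> n) i = p i \<and> snd (\<sigma> n) i = U i" if "i \<le> n" for i n
    using that
  proof (induction n rule: dec_induct)
    case base
    thus ?case by (simp add: p_def U_def)
  next
    case (step n)
    thus ?case using \<sigma>(2)[of n] by (auto simp: R_def split: prod.splits)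
  qed
  have p: "p n \<in> M" "openin Y (U n)" "f (p n) \<in> U n" for n
    using \<sigma>(1)[of n] by (auto simp: I_def p_def U_def split: prod.splits)
  have disj: "U i \<inter> U j = {}" if "i < j" for i j
  proof -
    have "snd (\<sigma> j) i \<inter> snd (\<sigma> j) j = {}" using \<sigma>(1)[of j] that by (auto simp: I_def split: prod.splits)
    thus ?thesis using stable[of i j] stable[of j j] that by auto
  qed
  hence disj': "U i \<inter> U j = {}" if "i \<noteq> j" for i j using that by (metis Int_commute linorder_neqE_nat)
  have near: "d (p (a n)) (p (Suc n)) < 1 / real (Suc n)" for n
  proof -
    have "d (fst (\<sigma> n) (a n)) (fst (\<sigma> (Suc n)) (Suc n)) < 1 / real (Suc n)"
      using \<sigma>(2)[of n] by (auto simp: R_def split: prod.splits)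
    thus ?thesis using stable[of "a n" n] stable[of "Suc n" "Suc n"] a by simp
  qed
  \<comment> \<open>The shift by one is due to stage \<open>n\<close> producing the point
    \<open>p (Suc n)\<close>, whose colour is the parity of \<open>n\<close>.\<close>
  define W where "W b = (\<Union>n\<in>{n. even n = b}. U (Suc n))" for b
  have "openin Y (W b)" for b using p(2) unfolding W_def by blast
  moreover have "W True \<inter> W False = {}"
  proof -
    have "U (Suc m) \<inter> U (Suc n) = {}" if "even m" "odd n" for m n
      using that by (intro disj') auto
    thus ?thesis unfolding W_def by blast
  qed
  moreover have "range p \<subseteq> topspace X" "range p \<noteq> {}" using p X by auto
  ultimately obtain V where V: "openin X V" "V \<inter> range p \<noteq> {}"
    "f ` (V \<inter> range p) \<inter> W True = {} \<or> f ` (V \<inter> range p) \<inter> W False = {}"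
    using separating[of "range p" "W True" "W False"] by blast
  then obtain i where "p i \<in> V" by blast
  then obtain \<delta> where \<delta>: "\<delta> > 0" "mball (p i) \<delta> \<subseteq> V" using V(1) X openin_mtopology by metis
  obtain k where k: "1 / real (Suc k) < \<delta>" using reals_Archimedean[OF \<delta>(1)] by (auto simp: inverse_eq_divide)
  have "f ` (V \<inter> range p) \<inter> W b \<noteq> {}" for b
  proof -
    \<comment> \<open>Halving and decoding \<open>n\<close> returns \<open>i\<close>, so
      \<open>p (Suc n)\<close> was chosen near \<open>p i\<close>; the last summand sets the colour,
      and \<open>k \<le> n\<close> makes the distance less than \<open>\<delta>\<close>.\<close>
    define n where "n = 2 * prod_encode (i, k) + (if b then 0 else 1)"
    have n: "a n = i" "even n = b" by (auto simp: a_def n_def)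
    have "k \<le> n" using le_prod_encode_2[of k i] by (simp add: n_def)
    hence "1 / real (Suc n) \<le> 1 / real (Suc k)" by (simp add: field_simps)
    hence "p (Suc n) \<in> mball (p i) \<delta>" using near[of n] n k p by auto
    hence "f (p (Suc n)) \<in> f ` (V \<inter> range p)" using \<delta> by blast
    moreover have "f (p (Suc n)) \<in> W b" using p n unfolding W_def by blast
    ultimately show ?thesis by blast
  qed
  thus False using V(3) by blast
qed

end

section \<open>Equivalence of the three conditions\<close>

theorem theorem7:
  fixes X :: "'a topology" and Y :: "'b topology" and f :: "'a \<Rightarrow> 'b"
  assumes "metrizable_space X" and "completely_Baire_space X"
    and "regular_space Y" and "t1_space Y"
    and "f \<in> topspace X \<rightarrow> topspace Y"
  shows "(resolvable_measurable X Y f \<longleftrightarrow> piecewise_continuous X Y f) \<and>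
         (piecewise_continuous X Y f \<longleftrightarrow> Pi02_measurable X Y f)"
proof -
  let ?pre = "\<lambda>U. {x \<in> topspace X. f x \<in> U}"
  have sep: "piecewise_continuous X Y f"
    if *: "\<And>T W W'. T \<subseteq> topspace X \<Longrightarrow> T \<noteq> {} \<Longrightarrow> openin Y W \<Longrightarrow> openin Y W' \<Longrightarrow> W \<inter> W' = {} \<Longrightarrow>
      \<exists>V. openin X V \<and> V \<inter> T \<noteq> {} \<and> (V \<inter> T \<inter> ?pre W = {} \<or> V \<inter> T \<inter> ?pre W' = {})"
  proof -
    interpret separating_map X Y f
    proof
      fix T W W'
      assume T: "T \<subseteq> topspace X" "T \<noteq> {}" and W: "openin Y W" "openin Y W'" "W \<inter> W' = {}"
      have "f ` (V \<inter> T) \<inter> W = {} \<longleftrightarrow> V \<inter> T \<inter> ?pre W = {}" for V W using T(1) by auto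
      with *[OF T W]
      show "\<exists>V. openin X V \<and> V \<inter> T \<noteq> {} \<and> (f ` (V \<inter> T) \<inter> W = {} \<or> f ` (V \<inter> T) \<inter> W' = {})"
        by simp
    qed (use assms in auto)
    show ?thesis using tame_topspace tame_imp_piecewise_continuous assms(1) by blast
  qed
  have "piecewise_continuous X Y f" if "resolvable_measurable X Y f"
  proof (rule sep)
    fix T W W'
    assume T: "T \<subseteq> topspace X" "T \<noteq> {}" and W: "openin Y W" "openin Y W'" "W \<inter> W' = {}"
    have "resolvable_in X (?pre W)" using that W unfolding resolvable_measurable_def by blast
    then obtain V where "openin X V" "V \<inter> T \<noteq> {}" "V \<inter> T \<subseteq> ?pre W \<or> V \<inter> T \<inter> ?pre W = {}"
      by (rule resolvable_in_locally_constant[OF _ T])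
    moreover have "?pre W \<inter> ?pre W' = {}" using W(3) by blast
    ultimately show "\<exists>V. openin X V \<and> V \<inter> T \<noteq> {} \<and> (V \<inter> T \<inter> ?pre W = {} \<or> V \<inter> T \<inter> ?pre W' = {})"
      by blast
  qed
  moreover have "piecewise_continuous X Y f" if "Pi02_measurable X Y f"
  proof (rule sep)
    fix T W W'
    assume T: "T \<subseteq> topspace X" "T \<noteq> {}" and W: "openin Y W" "openin Y W'" "W \<inter> W' = {}"
    have "gdelta_in X (?pre W)" "gdelta_in X (?pre W')"
      using that W unfolding Pi02_measurable_def by blast+
    moreover have "?pre W \<inter> ?pre W' = {}" using W(3) by blast
    ultimately show "\<exists>V. openin X V \<and> V \<inter> T \<noteq> {} \<and> (V \<inter> T \<inter> ?pre W = {} \<or> V \<inter> T \<inter> ?pre W' = {})"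
      using completely_Baire_separates_gdelta[OF assms(2) _ _ _ T] by blast
  qed
  moreover have "Pi02_measurable X Y f" if "piecewise_continuous X Y f"
    using piecewise_continuous_preimage(1)[OF assms(1) that assms(5)]
    unfolding Pi02_measurable_def by blast
  moreover have "resolvable_measurable X Y f" if pc: "piecewise_continuous X Y f"
    unfolding resolvable_measurable_def
  proof (intro allI impI)
    fix U assume "openin Y U"
    \<comment> \<open>The preimage and its complement are disjoint G-delta sets, so on each closed
      set the Baire argument gives a piece missing one of them, which is local constancy.\<close>
    note G = piecewise_continuous_preimage[OF assms(1) pc assms(5) this]
    show "resolvable_in X (?pre U)"
    proof (rule resolvable_in_if_locally_constant)
      fix C assume "closedin X C" "C \<noteq> {}"
      moreover from this have C: "C \<subseteq> topspace X" using closedin_subset by blast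
      ultimately obtain V where V: "openin X V" "V \<inter> C \<noteq> {}"
        "V \<inter> C \<inter> ?pre U = {} \<or> V \<inter> C \<inter> {x \<in> topspace X. f x \<notin> U} = {}"
        using completely_Baire_separates_gdelta[OF assms(2) G _ C] by blast
      have "V \<inter> C \<subseteq> ?pre U \<or> V \<inter> C \<inter> ?pre U = {}" using V(3) C by blast
      thus "\<exists>V. openin X V \<and> V \<inter> C \<noteq> {} \<and> (V \<inter> C \<subseteq> ?pre U \<or> V \<inter> C \<inter> ?pre U = {})"
        using V by blast
    qed auto
  qed
  ultimately show ?thesis by blast
qed

end
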